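(* There is a polynomial-time algorithm that, given a satisfiable projection game $G=(X,Y,E,\Sigma,\Pi)$ and two satisfying labelings $\psi_\mathsf{s},\psi_\mathsf{t}$ of $G$, decides whether there exists a reconfiguration sequence from $\psi_\mathsf{s}$ to $\psi_\mathsf{t}$ consisting only of satisfying labelings of $G$.
   Context: A game is $G=(X,Y,E,\Sigma,\Pi)$ where $(X\cup Y,E)$ is a finite bipartite graph with bipartition $(X,Y)$, $\Sigma$ a finite alphabet, and $\Pi=(\pi_e)_{e\in E}$ with $\pi_{(x,y)}\subseteq\Sigma\times\Sigma$ the admissible pairs (value of $x$, value of $y$). $G$ is a projection game if for every edge $(x,y)\in E$ and every $\beta\in\Sigma$ there is a unique $\alpha\in\Sigma$ with $(\alpha,\beta)\in\pi_{(x,y)}$. A labeling $\psi\colon X\cup Y\to\Sigma$ satisfies edge $(x,y)$ if $(\psi(x),\psi(y))\in\pi_{(x,y)}$, and satisfies $G$ if it satisfies all edges; $G$ is satisfiable if such a labeling exists. A reconfiguration sequence from $\psi_\mathsf{s}$ to $\psi_\mathsf{t}$ is a sequence of labelings starting at $\psi_\mathsf{s}$, ending at $\psi_\mathsf{t}$, with consecutive labelings differing in exactly one vertex. *)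

theory Defs
  imports "HOL-Library.FuncSet" "HOL-Computational_Algebra.Polynomial"
begin

section \<open>Games and reconfiguration\<close>

text \<open>
  Vertices of both sides share one type. An edge joining \<open>x\<close> in the left side to \<open>y\<close> in the right
  side is the ordered pair \<open>(x, y)\<close>.
\<close>

record ('v, 'a) game =
  left_part :: "'v set"
  right_part :: "'v set"
  edge_set :: "('v \<times> 'v) set"
  alphabet :: "'a set"
  constr :: "'v \<times> 'v \<Rightarrow> ('a \<times> 'a) set"

definition vertices :: "('v, 'a) game \<Rightarrow> 'v set" where
  "vertices G = left_part G \<union> right_part G"

definition is_game :: "('v, 'a) game \<Rightarrow> bool" where
  "is_game G \<longleftrightarrow>
     finite (left_part G) \<and> finite (right_part G) \<and> left_part G \<inter> right_part G = {} \<and>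
     edge_set G \<subseteq> left_part G \<times> right_part G \<and>
     finite (alphabet G) \<and>
     (\<forall>e\<in>edge_set G. constr G e \<subseteq> alphabet G \<times> alphabet G)"

definition projection_game :: "('v, 'a) game \<Rightarrow> bool" where
  "projection_game G \<longleftrightarrow>
     is_game G \<and>
     (\<forall>e\<in>edge_set G. \<forall>\<beta>\<in>alphabet G. \<exists>!\<alpha>. \<alpha> \<in> alphabet G \<and> (\<alpha>, \<beta>) \<in> constr G e)"

text \<open>
  Labelings are extensional functions, so equality of labelings is equality on the vertices.
\<close>

definition labelings :: "('v, 'a) game \<Rightarrow> ('v \<Rightarrow> 'a) set" where
  "labelings G = vertices G \<rightarrow>\<^sub>E alphabet G"

definition satisfies_edge :: "('v, 'a) game \<Rightarrow> ('v \<Rightarrow> 'a) \<Rightarrow> 'v \<times> 'v \<Rightarrow> bool" where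
  "satisfies_edge G \<psi> e \<longleftrightarrow> (\<psi> (fst e), \<psi> (snd e)) \<in> constr G e"

definition satisfying :: "('v, 'a) game \<Rightarrow> ('v \<Rightarrow> 'a) \<Rightarrow> bool" where
  "satisfying G \<psi> \<longleftrightarrow> \<psi> \<in> labelings G \<and> (\<forall>e\<in>edge_set G. satisfies_edge G \<psi> e)"

definition satisfiable :: "('v, 'a) game \<Rightarrow> bool" where
  "satisfiable G \<longleftrightarrow> (\<exists>\<psi>. satisfying G \<psi>)"

definition reconf_seq ::
  "('v, 'a) game \<Rightarrow> ('v \<Rightarrow> 'a) \<Rightarrow> ('v \<Rightarrow> 'a) \<Rightarrow> ('v \<Rightarrow> 'a) list \<Rightarrow> bool" where
  "reconf_seq G \<psi>s \<psi>t \<Psi> \<longleftrightarrow>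
     \<Psi> \<noteq> [] \<and> hd \<Psi> = \<psi>s \<and> last \<Psi> = \<psi>t \<and> set \<Psi> \<subseteq> labelings G \<and>
     (\<forall>i. Suc i < length \<Psi> \<longrightarrow> (\<exists>!v. v \<in> vertices G \<and> (\<Psi> ! i) v \<noteq> (\<Psi> ! Suc i) v))"

definition reconfigurable :: "('v, 'a) game \<Rightarrow> ('v \<Rightarrow> 'a) \<Rightarrow> ('v \<Rightarrow> 'a) \<Rightarrow> bool" where
  "reconfigurable G \<psi>s \<psi>t \<longleftrightarrow> (\<exists>\<Psi>. reconf_seq G \<psi>s \<psi>t \<Psi> \<and> (\<forall>\<psi>\<in>set \<Psi>. satisfying G \<psi>))"

section \<open>Encoding of inputs as words over a finite alphabet\<close>

datatype sym = Zero | One | Comma | Semicolon | Hash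

text \<open>Least significant bit first; the number 0 has the empty expansion.\<close>

fun bits :: "nat \<Rightarrow> sym list" where
  "bits n = (if n = 0 then [] else (if even n then Zero else One) # bits (n div 2))"

declare bits.simps [simp del]

definition enc_num :: "nat \<Rightarrow> sym list" where
  "enc_num n = bits n @ [Comma]"

definition enc_nums :: "nat list \<Rightarrow> sym list" where
  "enc_nums ns = concat (map enc_num ns)"

definition enc_pairs :: "(nat \<times> nat) list \<Rightarrow> sym list" where
  "enc_pairs ps = concat (map (\<lambda>(a, b). enc_num a @ enc_num b) ps)"

text \<open>
  Every edge is followed by the list of its admissible pairs, a labeling is the table of its values
  on the given list of vertices.
\<close>

definition enc_edges :: "(nat \<times> nat \<Rightarrow> (nat \<times> nat) list) \<Rightarrow> (nat \<times> nat) list \<Rightarrow> sym list" where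
  "enc_edges ps es = concat (map (\<lambda>e. enc_pairs (e # ps e) @ [Semicolon]) es)"

definition enc_labeling :: "nat list \<Rightarrow> (nat \<Rightarrow> nat) \<Rightarrow> sym list" where
  "enc_labeling vs \<psi> = enc_pairs (map (\<lambda>v. (v, \<psi> v)) vs)"

text \<open>
  A word encodes an instance if it arises by listing the finite sets involved, without repetition
  and in an arbitrary order.
\<close>

definition encodes ::
  "sym list \<Rightarrow> (nat, nat) game \<Rightarrow> (nat \<Rightarrow> nat) \<Rightarrow> (nat \<Rightarrow> nat) \<Rightarrow> bool" where
  "encodes w G \<psi>s \<psi>t \<longleftrightarrow>
     (\<exists>xs ys as es ps.
        distinct xs \<and> set xs = left_part G \<and>
        distinct ys \<and> set ys = right_part G \<and>
        distinct as \<and> set as = alphabet G \<and>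
        distinct es \<and> set es = edge_set G \<and>
        (\<forall>e\<in>edge_set G. distinct (ps e) \<and> set (ps e) = constr G e) \<and>
        w = enc_nums xs @ [Hash] @ enc_nums ys @ [Hash] @ enc_nums as @ [Hash] @
            enc_edges ps es @ [Hash] @
            enc_labeling (xs @ ys) \<psi>s @ [Hash] @ enc_labeling (xs @ ys) \<psi>t)"

section \<open>Deterministic multi-tape Turing machines\<close>

text \<open>
  States and tape symbols are numbers below the bounds \<open>num_states\<close> and \<open>num_symbols\<close>; symbol 0 is
  the blank. The tapes are infinite in both directions.
\<close>

datatype move = Move_Left | Stay | Move_Right

record tm =
  num_tapes :: nat
  num_states :: nat
  num_symbols :: nat
  start_state :: nat
  accept_state :: nat
  reject_state :: nat
  delta :: "nat \<Rightarrow> nat list \<Rightarrow> nat \<times> (nat \<times> move) list"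

fun sym_code :: "sym \<Rightarrow> nat" where
  "sym_code Zero = 1"
| "sym_code One = 2"
| "sym_code Comma = 3"
| "sym_code Semicolon = 4"
| "sym_code Hash = 5"

text \<open>
  Only the values of \<open>delta\<close> on states and symbols within the bounds matter, so the program of a
  machine is a finite table. The tape alphabet contains the blank and the five input symbols.
\<close>

definition turing_machine :: "tm \<Rightarrow> bool" where
  "turing_machine M \<longleftrightarrow>
     1 \<le> num_tapes M \<and> 6 \<le> num_symbols M \<and>
     start_state M < num_states M \<and> accept_state M < num_states M \<and>
     reject_state M < num_states M \<and> accept_state M \<noteq> reject_state M \<and>
     (\<forall>q < num_states M. \<forall>cs. length cs = num_tapes M \<and> set cs \<subseteq> {..<num_symbols M} \<longrightarrow>
        fst (delta M q cs) < num_states M \<and>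
        length (snd (delta M q cs)) = num_tapes M \<and>
        (\<forall>(c, m) \<in> set (snd (delta M q cs)). c < num_symbols M))"

text \<open>A tape is given by its contents and the position of the head.\<close>

type_synonym tape = "(int \<Rightarrow> nat) \<times> int"
type_synonym config = "nat \<times> tape list"

definition read_tape :: "tape \<Rightarrow> nat" where
  "read_tape T = fst T (snd T)"

fun shift :: "move \<Rightarrow> int" where
  "shift Move_Left = -1"
| "shift Stay = 0"
| "shift Move_Right = 1"

definition act_tape :: "tape \<Rightarrow> nat \<times> move \<Rightarrow> tape" where
  "act_tape T a = ((fst T)(snd T := fst a), snd T + shift (snd a))"

definition halted :: "tm \<Rightarrow> config \<Rightarrow> bool" where
  "halted M C \<longleftrightarrow> fst C = accept_state M \<or> fst C = reject_state M"

definition step :: "tm \<Rightarrow> config \<Rightarrow> config" where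
  "step M C =
     (if halted M C then C
      else let r = delta M (fst C) (map read_tape (snd C))
           in (fst r, map2 act_tape (snd C) (snd r)))"

definition input_tape :: "sym list \<Rightarrow> tape" where
  "input_tape w =
     (\<lambda>i. if 0 \<le> i \<and> i < int (length w) then sym_code (w ! nat i) else 0, 0)"

definition empty_tape :: tape where
  "empty_tape = (\<lambda>_. 0, 0)"

definition init_config :: "tm \<Rightarrow> sym list \<Rightarrow> config" where
  "init_config M w = (start_state M, input_tape w # replicate (num_tapes M - 1) empty_tape)"

definition run :: "tm \<Rightarrow> sym list \<Rightarrow> nat \<Rightarrow> config" where
  "run M w t = (step M ^^ t) (init_config M w)"

text \<open>Within \<open>t\<close> steps on input \<open>w\<close>, the machine halts with the answer \<open>b\<close>.\<close>

definition answers_within :: "tm \<Rightarrow> sym list \<Rightarrow> nat \<Rightarrow> bool \<Rightarrow> bool" where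
  "answers_within M w t b \<longleftrightarrow>
     fst (run M w t) = (if b then accept_state M else reject_state M)"

end

theory Submission
  imports Defs
begin

text \<open>
  The value of a vertex \<open>x\<close> on the left with an incident edge is determined by the value of any
  neighbour, so it never changes while all labelings satisfy the game. Conversely, if two satisfying
  labelings agree on these vertices, all other vertices can be relabeled one by one. Hence it
  suffices to compare \<open>\<psi>s x\<close> with \<open>\<psi>t x\<close> for every edge \<open>(x, y)\<close>; the constraints need not be
  read. A machine with three heads on copies of the input, one for the edges and one for each
  labeling, does this in cubic time.
\<close>

section \<open>Which labelings are reconfigurable into each other\<close>

text \<open>A step that changed \<open>x\<close> would leave its neighbour \<open>y\<close> alone,
  since only one vertex changes per step. The projection property then determines the value of
  \<open>x\<close> from the unchanged value of \<open>y\<close>, a contradiction.\<close>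

lemma reconf_seq_left_const:
  assumes G: "projection_game G" and seq: "reconf_seq G \<psi>s \<psi>t \<Psi>"
    and sat: "\<forall>\<psi>\<in>set \<Psi>. satisfying G \<psi>" and e: "(x, y) \<in> edge_set G"
  shows "i < length \<Psi> \<Longrightarrow> (\<Psi> ! i) x = \<psi>s x"
proof (induction i)
  case 0
  then show ?case using seq by (simp add: reconf_seq_def hd_conv_nth)
next
  case (Suc i)
  let ?\<phi> = "\<Psi> ! i" and ?\<chi> = "\<Psi> ! Suc i"
  have xy: "x \<in> vertices G" "y \<in> vertices G" "x \<noteq> y"
    using G e by (auto simp: projection_game_def is_game_def vertices_def)
  have s: "satisfying G ?\<phi>" "satisfying G ?\<chi>" using sat Suc.prems by auto
  have c: "(?\<phi> x, ?\<phi> y) \<in> constr G (x, y)" "(?\<chi> x, ?\<chi> y) \<in> constr G (x, y)"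
    using s e by (auto simp: satisfying_def satisfies_edge_def)
  have l: "?\<phi> x \<in> alphabet G" "?\<chi> x \<in> alphabet G" "?\<phi> y \<in> alphabet G"
    using s xy by (auto simp: satisfying_def labelings_def)
  have one: "\<exists>!v. v \<in> vertices G \<and> ?\<phi> v \<noteq> ?\<chi> v"
    using seq Suc.prems by (auto simp: reconf_seq_def)
  have "?\<phi> x = ?\<chi> x"
  proof (rule ccontr)
    assume d: "?\<phi> x \<noteq> ?\<chi> x"
    then have "?\<phi> y = ?\<chi> y" using one xy by blast
    moreover have "\<exists>!\<alpha>. \<alpha> \<in> alphabet G \<and> (\<alpha>, ?\<phi> y) \<in> constr G (x, y)"
      using G e l(3) by (auto simp: projection_game_def)
    ultimately show False using c l d by metis
  qed
  then show ?case using Suc by simp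
qed

text \<open>Induction on the number of vertices where \<open>\<phi>\<close> and
  \<open>\<psi>t\<close> differ: any one of them may be given its target value at once.\<close>

lemma reconfigurable_if_agree:
  assumes G: "projection_game G" and t: "satisfying G \<psi>t"
  shows "\<lbrakk>satisfying G \<phi>; \<forall>(x, y)\<in>edge_set G. \<phi> x = \<psi>t x\<rbrakk> \<Longrightarrow> reconfigurable G \<phi> \<psi>t"
proof (induction "card {v \<in> vertices G. \<phi> v \<noteq> \<psi>t v}" arbitrary: \<phi> rule: less_induct)
  case less
  have fin: "finite (vertices G)"
    using G by (simp add: projection_game_def is_game_def vertices_def)
  show ?case
  proof (cases "\<exists>v \<in> vertices G. \<phi> v \<noteq> \<psi>t v")
    case False
    then have "\<phi> = \<psi>t"
      using less.prems(1) t unfolding satisfying_def labelings_def by (metis PiE_ext)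
    then have "reconf_seq G \<phi> \<psi>t [\<phi>]"
      using t by (simp add: reconf_seq_def satisfying_def)
    then show ?thesis using less.prems(1) unfolding reconfigurable_def by fastforce
  next
    case True
    then obtain v where v: "v \<in> vertices G" "\<phi> v \<noteq> \<psi>t v" by blast
    let ?\<phi> = "\<phi>(v := \<psi>t v)"
    have "?\<phi> \<in> labelings G"
      using less.prems(1) t v by (auto simp: satisfying_def labelings_def PiE_iff extensional_def)
    moreover have "satisfies_edge G ?\<phi> e" if "e \<in> edge_set G" for e
    proof -
      obtain x y where [simp]: "e = (x, y)" by (cases e)
      \<comment> \<open>With the left endpoint already at its target value, the updated edge carries
        either its old pair or its target pair, and both are admissible.\<close>
      have "\<phi> x = \<psi>t x" using less.prems(2) that by auto
      moreover have "(\<phi> x, \<phi> y) \<in> constr G e" "(\<psi>t x, \<psi>t y) \<in> constr G e"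
        using less.prems(1) t that by (auto simp: satisfying_def satisfies_edge_def)
      ultimately show ?thesis using v by (auto simp: satisfies_edge_def)
    qed
    ultimately have sat: "satisfying G ?\<phi>" by (simp add: satisfying_def)
    have "{u \<in> vertices G. ?\<phi> u \<noteq> \<psi>t u} \<subset> {u \<in> vertices G. \<phi> u \<noteq> \<psi>t u}"
      using v by auto
    then have "card {u \<in> vertices G. ?\<phi> u \<noteq> \<psi>t u} < card {u \<in> vertices G. \<phi> u \<noteq> \<psi>t u}"
      using fin by (intro psubset_card_mono) auto
    moreover have "\<forall>(x, y)\<in>edge_set G. ?\<phi> x = \<psi>t x" using less.prems(2) by auto
    ultimately have "reconfigurable G ?\<phi> \<psi>t" using less.hyps sat by blast
    then obtain \<Psi> where \<Psi>: "reconf_seq G ?\<phi> \<psi>t \<Psi>" "\<forall>\<psi>\<in>set \<Psi>. satisfying G \<psi>"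
      unfolding reconfigurable_def by blast
    then have ne: "\<Psi> \<noteq> []" and hd: "\<Psi> ! 0 = ?\<phi>"
      by (auto simp: reconf_seq_def hd_conv_nth)
    have "\<exists>!u. u \<in> vertices G \<and> ((\<phi> # \<Psi>) ! i) u \<noteq> ((\<phi> # \<Psi>) ! Suc i) u"
      if "Suc i < length (\<phi> # \<Psi>)" for i
    proof (cases i)
      case 0
      show ?thesis unfolding 0 using v hd by (intro ex1I[of _ v]) (auto split: if_splits)
    next
      case (Suc j)
      then show ?thesis using \<Psi>(1) that by (auto simp: reconf_seq_def)
    qed
    then have "reconf_seq G \<phi> \<psi>t (\<phi> # \<Psi>)"
      using \<Psi>(1) less.prems(1) ne by (auto simp: reconf_seq_def satisfying_def)
    then show ?thesis using \<Psi>(2) less.prems(1) unfolding reconfigurable_def by fastforce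
  qed
qed

lemma reconfigurable_iff_agree:
  assumes "projection_game G" "satisfying G \<psi>s" "satisfying G \<psi>t"
  shows "reconfigurable G \<psi>s \<psi>t \<longleftrightarrow> (\<forall>(x, y)\<in>edge_set G. \<psi>s x = \<psi>t x)"
proof
  assume "reconfigurable G \<psi>s \<psi>t"
  then obtain \<Psi> where \<Psi>: "reconf_seq G \<psi>s \<psi>t \<Psi>" "\<forall>\<psi>\<in>set \<Psi>. satisfying G \<psi>"
    unfolding reconfigurable_def by blast
  then have "\<Psi> \<noteq> []" "\<Psi> ! (length \<Psi> - 1) = \<psi>t"
    by (auto simp: reconf_seq_def last_conv_nth)
  then show "\<forall>(x, y)\<in>edge_set G. \<psi>s x = \<psi>t x"
    using reconf_seq_left_const[OF assms(1) \<Psi>, where i = "length \<Psi> - 1"] by auto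
next
  assume "\<forall>(x, y)\<in>edge_set G. \<psi>s x = \<psi>t x"
  then show "reconfigurable G \<psi>s \<psi>t"
    using reconfigurable_if_agree assms by blast
qed

section \<open>Words\<close>

lemma sym_code_inject [simp]: "sym_code c = sym_code d \<longleftrightarrow> c = d"
  by (cases c; cases d) simp_all

lemma sym_code_neq_0 [simp]: "sym_code c \<noteq> 0"
  by (cases c) simp_all

declare sym_code.simps [simp del]

lemma set_bits: "set (bits n) \<subseteq> {Zero, One}"
  by (induction n rule: bits.induct) (subst bits.simps, auto)

text \<open>The first symbol gives the parity and the rest gives the half. Hence the machine can
  decide equality of numbers by comparing symbols.\<close>

lemma bits_inject: "bits m = bits n \<Longrightarrow> m = n"
proof (induction m arbitrary: n rule: bits.induct)
  case (1 m)
  show ?case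
  proof (cases "m = 0")
    case True
    then show ?thesis using "1.prems" by (simp add: bits.simps[of 0] bits.simps[of n] split: if_splits)
  next
    case False
    then have n: "n \<noteq> 0"
      using "1.prems" by (cases "n = 0") (simp_all add: bits.simps[of 0] bits.simps[of m])
    have "even m \<longleftrightarrow> even n" "bits (m div 2) = bits (n div 2)"
      using "1.prems" False n by (simp_all add: bits.simps[of m] bits.simps[of n] split: if_splits)
    then show ?thesis using "1.IH"[OF False] by (metis div_mod_decomp parity_cases)
  qed
qed

lemma Comma_notin_bits: "Comma \<notin> set (bits n)"
  using set_bits by blast

text \<open>Separators never occur inside numbers; this is what lets the scans for
  \<open>Hash\<close> and \<open>Semicolon\<close> stop at the intended place.\<close>

lemma Hash_notin_enc_num: "Hash \<notin> set (enc_num n)" and Semicolon_notin_enc_num: "Semicolon \<notin> set (enc_num n)"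
  using set_bits[of n] by (auto simp: enc_num_def)

lemma Semicolon_notin_enc_pairs: "Semicolon \<notin> set (enc_pairs ps)"
  using Semicolon_notin_enc_num by (auto simp: enc_pairs_def)

lemma Hash_notin_enc_pairs: "Hash \<notin> set (enc_pairs ps)"
  using Hash_notin_enc_num by (auto simp: enc_pairs_def)

lemma Hash_notin_enc_labeling: "Hash \<notin> set (enc_labeling vs \<psi>)"
  by (simp add: enc_labeling_def Hash_notin_enc_pairs)

lemma Hash_notin_enc_edges: "Hash \<notin> set (enc_edges ps es)"
  using Hash_notin_enc_pairs by (auto simp: enc_edges_def)

lemma enc_pairs_Cons: "enc_pairs ((a, b) # ps) = enc_num a @ enc_num b @ enc_pairs ps"
  by (simp add: enc_pairs_def)

lemma enc_labeling_Cons: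
  "enc_labeling (v # vs) \<psi> = enc_num v @ enc_num (\<psi> v) @ enc_labeling vs \<psi>"
  by (simp add: enc_labeling_def enc_pairs_Cons)

lemma enc_edges_Nil: "enc_edges ps [] = []"
  and enc_edges_Cons: "enc_edges ps ((x, y) # es) =
    enc_num x @ (enc_num y @ enc_pairs (ps (x, y))) @ [Semicolon] @ enc_edges ps es"
  by (simp_all add: enc_edges_def enc_pairs_Cons)

lemma length_enc_num: "length (enc_num n) = Suc (length (bits n))"
  by (simp add: enc_num_def)

lemma length_vs_le_enc_labeling: "length vs \<le> length (enc_labeling vs \<psi>)"
  by (induction vs) (auto simp: enc_labeling_Cons length_enc_num)

lemma length_es_le_enc_edges: "length es \<le> length (enc_edges ps es)"
  by (induction es) (auto simp: enc_edges_Cons enc_edges_Nil length_enc_num)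

text \<open>The terminator makes the words prefix-free: if one is a proper prefix of the other, its
  comma meets a different symbol. So a symbolwise comparison finds a difference before running past
  either number.\<close>

lemma comma_terminated_diff:
  assumes "u \<noteq> v" "Comma \<notin> set u" "Comma \<notin> set v"
  obtains s c u' d v' where "u @ [Comma] = s @ c # u'" "v @ [Comma] = s @ d # v'" "c \<noteq> d"
    "Comma \<notin> set s" "set s \<subseteq> set u"
proof -
  have "\<exists>s c u' d v'. u @ [Comma] = s @ c # u' \<and> v @ [Comma] = s @ d # v' \<and> c \<noteq> d \<and> set s \<subseteq> set u"
    using assms
  proof (induction u arbitrary: v)
    case Nil
    then show ?case by (cases v) fastforce+
  next
    case (Cons a u)
    show ?case
    proof (cases "v \<noteq> [] \<and> hd v = a")
      case True
      then obtain v0 where v: "v = a # v0" by (cases v) auto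
      with Cons obtain s c u' d v' where "u @ [Comma] = s @ c # u'" "v0 @ [Comma] = s @ d # v'"
        "c \<noteq> d" "set s \<subseteq> set u"
        by (metis list.set_intros(2))
      then show ?thesis using v by (intro exI[of _ "a # s"]) auto
    next
      case False
      \<comment> \<open>Either the first letters differ, or \<open>v\<close> is empty and its
        \<open>Comma\<close> stands against \<open>a\<close>.\<close>
      then show ?thesis using Cons.prems
        by (intro exI[of _ "[]"]) (cases v; auto)
    qed
  qed
  then show ?thesis using assms that by blast
qed

primrec word_at :: "(int \<Rightarrow> nat) \<Rightarrow> int \<Rightarrow> sym list \<Rightarrow> bool" where
  "word_at f p [] \<longleftrightarrow> True"
| "word_at f p (c # s) \<longleftrightarrow> f p = sym_code c \<and> word_at f (p + 1) s"

lemma word_at_append: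
  "word_at f p (s @ t) \<longleftrightarrow> word_at f p s \<and> word_at f (p + int (length s)) t"
  by (induction s arbitrary: p) (auto simp: algebra_simps)

lemma word_at_nth: "word_at f p s \<longleftrightarrow> (\<forall>i < length s. f (p + int i) = sym_code (s ! i))"
proof (induction s arbitrary: p)
  case (Cons c s)
  then show ?case by (auto simp: less_Suc_eq_0_disj algebra_simps)
qed simp

text \<open>Ensures that a scan for \<open>d\<close> does not stop inside a word free of
  \<open>d\<close>.\<close>

lemma word_at_neq:
  assumes "word_at f p s" "d \<notin> set s" "i < length s"
  shows "f (p + int i) \<noteq> sym_code d"
  using assms by (metis nth_mem sym_code_inject word_at_nth)

lemma word_at_input_tape: "word_at (fst (input_tape w)) 0 w"
  by (simp add: word_at_nth input_tape_def)

section \<open>A Turing machine comparing the labelings\<close>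

text \<open>
  State 0 copies the input to the other two tapes, and no later state changes a tape. Head \<open>A\<close>
  then serves the edge list, heads \<open>B\<close> and \<open>C\<close> serve the tables of the two labelings. States 1 to 3
  place the heads. State 4 compares the left endpoint \<open>x\<close> of the current edge with the vertex of the
  current table entry; as both tables list the vertices in the same order, \<open>C\<close> moves in step
  with \<open>B\<close>. If they agree, state 5 compares the two values and states 6 to 8 pass to the next edge,
  otherwise states 9 to 12 pass to the next table entry and return to the beginning of \<open>x\<close>. Since
  \<open>x\<close> is a vertex, the tables are never exhausted. States 13 and 14 accept and reject.
\<close>

definition program :: "nat \<Rightarrow> nat \<Rightarrow> nat \<Rightarrow> nat \<Rightarrow> nat \<times> move \<times> move \<times> move" where
  "program q a b c =
    (if q = 0 then
       if a = 0 then (1, Move_Left, Move_Left, Move_Left)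
       else (0, Move_Right, Move_Right, Move_Right)
     else if q = 1 then
       if a = sym_code Hash then (2, Move_Left, Move_Left, Move_Right)
       else (1, Move_Left, Move_Left, Move_Left)
     else if q = 2 then
       if a = sym_code Hash then (3, Move_Left, Move_Right, Stay)
       else (2, Move_Left, Move_Left, Stay)
     else if q = 3 then
       if a = sym_code Hash then (4, Move_Right, Stay, Stay)
       else (3, Move_Left, Stay, Stay)
     else if q = 4 then
       if a = sym_code Hash then (13, Stay, Stay, Stay)
       else if a \<noteq> b then (9, Stay, Stay, Stay)
       else if a = sym_code Comma then (5, Stay, Move_Right, Move_Right)
       else (4, Move_Right, Move_Right, Move_Right)
     else if q = 5 then
       if b \<noteq> c then (14, Stay, Stay, Stay)
       else if b = sym_code Comma then (6, Stay, Stay, Stay)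
       else (5, Stay, Move_Right, Move_Right)
     else if q = 6 then
       if b = sym_code Hash then (7, Stay, Move_Right, Stay)
       else (6, Stay, Move_Left, Stay)
     else if q = 7 then
       if c = sym_code Hash then (8, Stay, Stay, Move_Right)
       else (7, Stay, Stay, Move_Left)
     else if q = 8 then
       if a = sym_code Semicolon then (4, Move_Right, Stay, Stay)
       else (8, Move_Right, Stay, Stay)
     else if q = 9 then
       if b = sym_code Comma then (10, Stay, Move_Right, Move_Right)
       else (9, Stay, Move_Right, Move_Right)
     else if q = 10 then
       if b = sym_code Comma then (11, Stay, Move_Right, Stay)
       else (10, Stay, Move_Right, Stay)
     else if q = 11 then
       if c = sym_code Comma then (12, Stay, Stay, Move_Right)
       else (11, Stay, Stay, Move_Right)
     else
       if a = sym_code Hash \<or> a = sym_code Semicolon then (4, Move_Right, Stay, Stay)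
       else (12, Move_Left, Stay, Stay))"

text \<open>In state 0 the symbol read on the first tape is written to all three, which produces the
  copies; every other state writes back what it reads.\<close>

definition machine :: tm where
  "machine = \<lparr>num_tapes = 3, num_states = 15, num_symbols = 6,
     start_state = 0, accept_state = 13, reject_state = 14,
     delta = (\<lambda>q cs. let (q', ma, mb, mc) = program q (cs ! 0) (cs ! 1) (cs ! 2)
       in (q', if q = 0 then [(cs ! 0, ma), (cs ! 0, mb), (cs ! 0, mc)]
               else [(cs ! 0, ma), (cs ! 1, mb), (cs ! 2, mc)]))\<rparr>"

lemma program_state: "fst (program q a b c) < 15"
  by (simp add: program_def)

lemma machine_simps [simp]:
  "num_tapes machine = 3" "num_states machine = 15" "num_symbols machine = 6"
  "start_state machine = 0" "accept_state machine = 13" "reject_state machine = 14"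
  by (simp_all add: machine_def)

lemma turing_machine_machine: "turing_machine machine"
proof -
  have "fst (delta machine q cs) < 15 \<and> length (snd (delta machine q cs)) = 3 \<and>
      (\<forall>(c, m) \<in> set (snd (delta machine q cs)). c < 6)"
    if cs: "length cs = 3" "set cs \<subseteq> {..<6}" for q cs
  proof -
    have "cs ! 0 < 6" "cs ! 1 < 6" "cs ! 2 < 6"
      using cs by (metis lessThan_iff nth_mem numeral_3_eq_3 subsetD zero_less_Suc One_nat_def
          numeral_2_eq_2 Suc_mono)+
    then show ?thesis
      using program_state[of q "cs ! 0" "cs ! 1" "cs ! 2"]
      by (auto simp: machine_def split: prod.split)
  qed
  then show ?thesis
    unfolding turing_machine_def machine_simps by (intro conjI allI impI; (blast | simp))
qed

text \<open>Bounding the number of steps, instead of fixing it, lets bounds be added along a run and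
  rounded up.\<close>

definition reaches :: "nat \<Rightarrow> config \<Rightarrow> config \<Rightarrow> bool" where
  "reaches t C D \<longleftrightarrow> (\<exists>k\<le>t. (step machine ^^ k) C = D)"

lemma reaches_refl: "reaches t C C"
  unfolding reaches_def by (intro exI[of _ 0]) simp

lemma reaches_trans [trans]:
  assumes "reaches s C D" "reaches t D E" shows "reaches (s + t) C E"
proof -
  from assms obtain k l where "k \<le> s" "(step machine ^^ k) C = D" "l \<le> t" "(step machine ^^ l) D = E"
    unfolding reaches_def by blast
  then have "(step machine ^^ (l + k)) C = E" "l + k \<le> s + t"
    by (simp_all add: funpow_add)
  then show ?thesis unfolding reaches_def by blast
qed

lemma reaches_mono: "reaches s C D \<Longrightarrow> s \<le> t \<Longrightarrow> reaches t C D"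
  unfolding reaches_def using order_trans by blast

lemma reaches_step: "step machine C = D \<Longrightarrow> reaches 1 C D"
  unfolding reaches_def by (intro exI[of _ 1]) simp

text \<open>Halted configurations are fixed points of \<open>step\<close>, so the bound may be taken
  as the exact number of steps, as \<open>answers_within\<close> requires.\<close>

lemma reaches_halted:
  assumes "reaches t C D" "halted machine D"
  shows "(step machine ^^ t) C = D"
proof -
  obtain k where k: "k \<le> t" "(step machine ^^ k) C = D" using assms(1) unfolding reaches_def by blast
  have "step machine D = D" using assms(2) by (simp add: step_def)
  then have "(step machine ^^ n) D = D" for n by (induction n) simp_all
  then show ?thesis using k by (metis funpow_add comp_apply le_add_diff_inverse2)
qed

section \<open>Runs with three copies of a word on the tapes\<close>

context
  fixes f :: "int \<Rightarrow> nat"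
begin

text \<open>After copying, the common tape contents \<open>f\<close> never change, so a
  configuration amounts to a state and three head positions.\<close>

definition conf :: "nat \<Rightarrow> int \<Rightarrow> int \<Rightarrow> int \<Rightarrow> config" where
  "conf q a b c = (q, [(f, a), (f, b), (f, c)])"

lemma fst_conf [simp]: "fst (conf q a b c) = q"
  by (simp add: conf_def)

lemma conf_step:
  assumes "0 < q" "q < 13" "program q (f a) (f b) (f c) = (q', ma, mb, mc)"
  shows "reaches 1 (conf q a b c) (conf q' (a + shift ma) (b + shift mb) (c + shift mc))"
  using assms
  by (intro reaches_step)
     (simp add: conf_def step_def halted_def machine_def read_tape_def act_tape_def)

lemma conf_scan:
  assumes "0 < q" "q < 13"
    and "\<And>i. i < m \<Longrightarrow> program q (f (a + int i * shift ma)) (f (b + int i * shift mb))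
      (f (c + int i * shift mc)) = (q, ma, mb, mc)"
  shows "reaches m (conf q a b c)
    (conf q (a + int m * shift ma) (b + int m * shift mb) (c + int m * shift mc))"
  using assms(3)
proof (induction m)
  case 0
  then show ?case by (simp add: reaches_refl)
next
  case (Suc m)
  then have "reaches m (conf q a b c)
    (conf q (a + int m * shift ma) (b + int m * shift mb) (c + int m * shift mc))" by simp
  from reaches_trans[OF this conf_step[OF assms(1,2) Suc.prems[OF lessI]]]
  show ?case by (simp add: algebra_simps)
qed

text \<open>A scan with \<open>m\<close> identical moves, followed by the one step that leaves the
  state. The rules for placing, rewinding and skipping are instances.\<close>

lemma conf_seek:
  assumes "0 < q" "q < 13"
    and "\<And>i. i < m \<Longrightarrow> program q (f (a + int i * shift ma)) (f (b + int i * shift mb))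
      (f (c + int i * shift mc)) = (q, ma, mb, mc)"
    and "program q (f (a + int m * shift ma)) (f (b + int m * shift mb))
      (f (c + int m * shift mc)) = (q', na, nb, nc)"
  shows "reaches (m + 1) (conf q a b c)
    (conf q' (a + int m * shift ma + shift na) (b + int m * shift mb + shift nb)
      (c + int m * shift mc + shift nc))"
  using reaches_trans[OF conf_scan[OF assms(1-3)] conf_step[OF assms(1,2,4)]] by simp

text \<open>Says that a head moving left from \<open>r\<close> in search of a symbol in
  \<open>D\<close> stops exactly at \<open>p\<close>.\<close>

definition barrier :: "sym set \<Rightarrow> int \<Rightarrow> int \<Rightarrow> bool" where
  "barrier D p r \<longleftrightarrow>
     p \<le> r \<and> f p \<in> sym_code ` D \<and> (\<forall>j. p < j \<and> j \<le> r \<longrightarrow> f j \<notin> sym_code ` D)"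

lemma barrier_word_at:
  assumes "f p \<in> sym_code ` D" "word_at f (p + 1) s" "set s \<inter> D = {}" "0 \<le> k" "k \<le> int (length s)"
  shows "barrier D p (p + k)"
proof -
  have "f j \<notin> sym_code ` D" if j: "p < j" "j \<le> p + k" for j
  proof -
    define i where "i = nat (j - p - 1)"
    have i: "i < length s" "j = p + 1 + int i" using j assms(5) by (auto simp: i_def)
    then have "f j = sym_code (s ! i)" using assms(2) by (simp add: word_at_nth)
    moreover have "s ! i \<notin> D" using assms(3) nth_mem[OF i(1)] by blast
    ultimately show ?thesis by auto
  qed
  then show ?thesis using assms by (auto simp: barrier_def)
qed

section \<open>Scans in the individual states\<close>

lemma place_1:
  assumes "barrier {Hash} p r"
  shows "reaches (nat (r - p) + 1) (conf 1 r r r) (conf 2 (p - 1) (p - 1) (p + 1))"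
  using conf_seek[of 1 "nat (r - p)" r Move_Left r Move_Left r Move_Left 2 Move_Left Move_Left Move_Right]
    assms by (simp add: barrier_def program_def)

lemma place_2:
  assumes "barrier {Hash} p r"
  shows "reaches (nat (r - p) + 1) (conf 2 r r c) (conf 3 (p - 1) (p + 1) c)"
  using conf_seek[of 2 "nat (r - p)" r Move_Left r Move_Left c Stay 3 Move_Left Move_Right Stay]
    assms by (simp add: barrier_def program_def)

lemma place_3:
  assumes "barrier {Hash} p r"
  shows "reaches (nat (r - p) + 1) (conf 3 r b c) (conf 4 (p + 1) b c)"
  using conf_seek[of 3 "nat (r - p)" r Move_Left b Stay c Stay 4 Move_Right Stay Stay]
    assms by (simp add: barrier_def program_def)

lemma rewind_6:
  assumes "barrier {Hash} p r"
  shows "reaches (nat (r - p) + 1) (conf 6 a r c) (conf 7 a (p + 1) c)"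
  using conf_seek[of 6 "nat (r - p)" a Stay r Move_Left c Stay 7 Stay Move_Right Stay]
    assms by (simp add: barrier_def program_def)

lemma rewind_7:
  assumes "barrier {Hash} p r"
  shows "reaches (nat (r - p) + 1) (conf 7 a b r) (conf 8 a b (p + 1))"
  using conf_seek[of 7 "nat (r - p)" a Stay b Stay r Move_Left 8 Stay Stay Move_Right]
    assms by (simp add: barrier_def program_def)

lemma rewind_12:
  assumes "barrier {Hash, Semicolon} p r"
  shows "reaches (nat (r - p) + 1) (conf 12 r b c) (conf 4 (p + 1) b c)"
  using conf_seek[of 12 "nat (r - p)" r Move_Left b Stay c Stay 4 Move_Right Stay Stay]
    assms by (simp add: barrier_def program_def)

lemma skip_8:
  assumes "word_at f a (s @ [Semicolon])" "Semicolon \<notin> set s"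
  shows "reaches (length s + 1) (conf 8 a b c) (conf 4 (a + int (length s) + 1) b c)"
  using conf_seek[of 8 "length s" a Move_Right b Stay c Stay 4 Move_Right Stay Stay]
    assms word_at_neq[of f a s Semicolon] by (simp add: word_at_append program_def)

text \<open>Only the head at \<open>b\<close> looks for the comma; the head at \<open>c\<close>
  moves along, which keeps it aligned because both tables have the same keys.\<close>

lemma skip_9:
  assumes "word_at f b (s @ [Comma])" "Comma \<notin> set s"
  shows "reaches (length s + 1) (conf 9 a b c)
    (conf 10 a (b + int (length s) + 1) (c + int (length s) + 1))"
  using conf_seek[of 9 "length s" a Stay b Move_Right c Move_Right 10 Stay Move_Right Move_Right]
    assms word_at_neq[of f b s Comma] by (simp add: word_at_append program_def)

lemma skip_10:
  assumes "word_at f b (s @ [Comma])" "Comma \<notin> set s"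
  shows "reaches (length s + 1) (conf 10 a b c) (conf 11 a (b + int (length s) + 1) c)"
  using conf_seek[of 10 "length s" a Stay b Move_Right c Stay 11 Stay Move_Right Stay]
    assms word_at_neq[of f b s Comma] by (simp add: word_at_append program_def)

lemma skip_11:
  assumes "word_at f c (s @ [Comma])" "Comma \<notin> set s"
  shows "reaches (length s + 1) (conf 11 a b c) (conf 12 a b (c + int (length s) + 1))"
  using conf_seek[of 11 "length s" a Stay b Stay c Move_Right 12 Stay Stay Move_Right]
    assms word_at_neq[of f c s Comma] by (simp add: word_at_append program_def)

section \<open>Comparison of keys and values\<close>

lemma compare_4:
  assumes "word_at f a s" "word_at f b s" "Comma \<notin> set s" "Hash \<notin> set s"
  shows "reaches (length s) (conf 4 a b c)
    (conf 4 (a + int (length s)) (b + int (length s)) (c + int (length s)))"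
  using conf_scan[of 4 "length s" a Move_Right b Move_Right c Move_Right]
    assms word_at_neq[of f a s] by (simp add: word_at_nth program_def)

lemma compare_5:
  assumes "word_at f b s" "word_at f c s" "Comma \<notin> set s"
  shows "reaches (length s) (conf 5 a b c)
    (conf 5 a (b + int (length s)) (c + int (length s)))"
  using conf_scan[of 5 "length s" a Stay b Move_Right c Move_Right]
    assms word_at_neq[of f c s] by (simp add: word_at_nth program_def)

text \<open>Heads B and C pass the comma and reach the values, while head A waits on the comma after
  \<open>x\<close>; hence the offset \<open>length (bits x)\<close> for A.\<close>

lemma key_match:
  assumes "word_at f a (enc_num x)" "word_at f b (enc_num x)"
  shows "reaches (length (enc_num x)) (conf 4 a b c)
    (conf 5 (a + int (length (bits x))) (b + int (length (enc_num x))) (c + int (length (enc_num x))))"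
proof -
  let ?n = "int (length (bits x))"
  have "reaches (length (bits x)) (conf 4 a b c) (conf 4 (a + ?n) (b + ?n) (c + ?n))"
    using assms set_bits[of x] by (intro compare_4) (auto simp: enc_num_def word_at_append)
  also have "reaches 1 (conf 4 (a + ?n) (b + ?n) (c + ?n)) (conf 5 (a + ?n) (b + ?n + 1) (c + ?n + 1))"
    using conf_step[of 4 "a + ?n" "b + ?n" "c + ?n" 5 Stay Move_Right Move_Right] assms
    by (simp add: enc_num_def word_at_append program_def)
  finally show ?thesis by (simp add: length_enc_num algebra_simps)
qed

text \<open>State 4 runs through the common prefix, whose length is \<open>k\<close>, and state 9
  finishes the key \<open>v\<close>. The bound on \<open>k\<close> limits the later rewind of head
  A.\<close>

lemma key_mismatch:
  assumes "word_at f a (enc_num x)" "word_at f b (enc_num v)" "x \<noteq> v"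
  obtains k where "k \<le> length (bits x)"
    "reaches (length (enc_num v) + 1) (conf 4 a b c)
      (conf 10 (a + int k) (b + int (length (enc_num v))) (c + int (length (enc_num v))))"
proof -
  have "bits x \<noteq> bits v" using assms(3) bits_inject by blast
  from comma_terminated_diff[OF this Comma_notin_bits Comma_notin_bits]
  obtain s y u' z v' where s: "bits x @ [Comma] = s @ y # u'" "bits v @ [Comma] = s @ z # v'"
    "y \<noteq> z" "Comma \<notin> set s" "set s \<subseteq> set (bits x)" .
  \<comment> \<open>What remains of the key from the first difference on still ends in its comma. If
    the difference is that comma, \<open>v''\<close> is empty and state 9 stops at once.\<close>
  obtain v'' where v'': "z # v' = v'' @ [Comma]"
    by (metis s(2) append_is_Nil_conv last_appendR last_snoc list.distinct(1) append_butlast_last_id)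
  then have v: "bits v = s @ v''" using s(2) by simp
  let ?n = "int (length s)"
  have at: "word_at f a (s @ y # u')" "word_at f b (s @ z # v')" "word_at f b (s @ v'' @ [Comma])"
    using assms(1,2) s v by (simp_all add: enc_num_def)
  have y: "y \<in> set (bits x @ [Comma])" unfolding s(1) by simp
  \<comment> \<open>A \<open>Hash\<close> under head A would be taken for the end of the edge list
    and accepted.\<close>
  have H: "Hash \<notin> set s" "y \<noteq> Hash" using y s(5) set_bits[of x] by auto
  have "reaches (length s) (conf 4 a b c) (conf 4 (a + ?n) (b + ?n) (c + ?n))"
    using at s(4) H by (intro compare_4) (auto simp: word_at_append)
  also have "reaches 1 (conf 4 (a + ?n) (b + ?n) (c + ?n)) (conf 9 (a + ?n) (b + ?n) (c + ?n))"
    using conf_step[of 4 "a + ?n" "b + ?n" "c + ?n" 9 Stay Stay Stay] at H s(3)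
    by (simp add: word_at_append program_def)
  also have "reaches (length v'' + 1) (conf 9 (a + ?n) (b + ?n) (c + ?n))
      (conf 10 (a + ?n) (b + ?n + int (length v'') + 1) (c + ?n + int (length v'') + 1))"
    using at(3) Comma_notin_bits[of v] v by (intro skip_9) (auto simp: word_at_append)
  finally have "reaches (length (enc_num v) + 1) (conf 4 a b c)
      (conf 10 (a + int (length s)) (b + int (length (enc_num v))) (c + int (length (enc_num v))))"
    by (simp add: length_enc_num v algebra_simps)
  moreover have "length s \<le> length (bits x)"
    using arg_cong[OF s(1), of length] by simp
  ultimately show ?thesis using that by blast
qed

lemma value_match:
  assumes "word_at f b (enc_num m)" "word_at f c (enc_num m)"
  shows "reaches (length (enc_num m)) (conf 5 a b c)
    (conf 6 a (b + int (length (bits m))) (c + int (length (bits m))))"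
proof -
  let ?n = "int (length (bits m))"
  have "reaches (length (bits m)) (conf 5 a b c) (conf 5 a (b + ?n) (c + ?n))"
    using assms set_bits[of m] by (intro compare_5) (auto simp: enc_num_def word_at_append)
  also have "reaches 1 (conf 5 a (b + ?n) (c + ?n)) (conf 6 a (b + ?n) (c + ?n))"
    using conf_step[of 5 a "b + ?n" "c + ?n" 6 Stay Stay Stay] assms
    by (simp add: enc_num_def word_at_append program_def)
  finally show ?thesis by (simp add: length_enc_num)
qed

lemma value_mismatch:
  assumes "word_at f b (enc_num m)" "word_at f c (enc_num n)" "m \<noteq> n"
  shows "\<exists>C. fst C = 14 \<and> reaches (length (enc_num m)) (conf 5 a b c) C"
proof -
  have "bits m \<noteq> bits n" using assms(3) bits_inject by blast
  from comma_terminated_diff[OF this Comma_notin_bits Comma_notin_bits]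
  obtain s y u' z v' where s: "bits m @ [Comma] = s @ y # u'" "bits n @ [Comma] = s @ z # v'"
    "y \<noteq> z" "Comma \<notin> set s" "set s \<subseteq> set (bits m)" .
  let ?n = "int (length s)"
  have at: "word_at f b (s @ y # u')" "word_at f c (s @ z # v')"
    using assms(1,2) s by (simp_all add: enc_num_def)
  have "reaches (length s) (conf 5 a b c) (conf 5 a (b + ?n) (c + ?n))"
    using at s(4) by (intro compare_5) (auto simp: word_at_append)
  also have "reaches 1 (conf 5 a (b + ?n) (c + ?n)) (conf 14 a (b + ?n) (c + ?n))"
    using conf_step[of 5 a "b + ?n" "c + ?n" 14 Stay Stay Stay] at s(3)
    by (simp add: word_at_append program_def)
  finally have "reaches (length (enc_num m)) (conf 5 a b c) (conf 14 a (b + ?n) (c + ?n))"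
    by (rule reaches_mono) (use arg_cong[OF s(1), of length] in \<open>simp add: enc_num_def\<close>)
  then show ?thesis by (intro exI[of _ "conf 14 a (b + ?n) (c + ?n)"]) simp
qed

section \<open>Table search and loop over the edges\<close>

text \<open>Induction on the table, at most \<open>6 * N\<close> steps per entry. The separator
  before \<open>x\<close> is where head A turns around after a mismatch. The final offsets
  \<open>i\<close> and \<open>j\<close> need only lie inside the tables, because both heads are
  rewound afterwards.\<close>

lemma lookup:
  assumes "x \<in> set vs" "word_at f a (enc_num x)" "f (a - 1) \<in> {sym_code Hash, sym_code Semicolon}"
    and "word_at f b (enc_labeling vs \<phi>)" "word_at f c (enc_labeling vs \<chi>)"
    and "length (enc_num x) \<le> N" "length (enc_labeling vs \<phi>) \<le> N" "length (enc_labeling vs \<chi>) \<le> N"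
  shows "if \<phi> x = \<chi> x
    then \<exists>i < length (enc_labeling vs \<phi>). \<exists>j < length (enc_labeling vs \<chi>).
      reaches (6 * N * length vs) (conf 4 a b c) (conf 6 (a + int (length (bits x))) (b + int i) (c + int j))
    else \<exists>C. fst C = 14 \<and> reaches (6 * N * length vs) (conf 4 a b c) C"
  using assms(1,4,5,7,8)
proof (induction vs arbitrary: b c)
  case Nil
  then show ?case by simp
next
  case (Cons v vs)
  let ?l = "\<lambda>n. int (length (enc_num n))"
  have at: "word_at f b (enc_num v)" "word_at f c (enc_num v)"
    "word_at f (b + ?l v) (enc_num (\<phi> v))" "word_at f (c + ?l v) (enc_num (\<chi> v))"
    "word_at f (b + ?l v + ?l (\<phi> v)) (enc_labeling vs \<phi>)"
    "word_at f (c + ?l v + ?l (\<chi> v)) (enc_labeling vs \<chi>)"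
    using Cons.prems(2,3) by (auto simp: enc_labeling_Cons word_at_append)
  have len: "length (enc_num v) + length (enc_num (\<phi> v)) + length (enc_labeling vs \<phi>) \<le> N"
    "length (enc_num v) + length (enc_num (\<chi> v)) + length (enc_labeling vs \<chi>) \<le> N"
    using Cons.prems(4,5) by (auto simp: enc_labeling_Cons)
  have N: "1 \<le> N" using assms(6) by (simp add: length_enc_num)
  show ?case
  proof (cases "x = v")
    case True
    have key: "reaches (length (enc_num v)) (conf 4 a b c)
        (conf 5 (a + int (length (bits x))) (b + ?l v) (c + ?l v))"
      using key_match[OF assms(2)] at(1) True by simp
    show ?thesis
    proof (cases "\<phi> x = \<chi> x")
      case eq: True
      let ?n = "length (enc_num v) + length (bits (\<phi> v))"
      have "reaches (length (enc_num v) + length (enc_num (\<phi> v))) (conf 4 a b c)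
          (conf 6 (a + int (length (bits x))) (b + int ?n) (c + int ?n))"
        using reaches_trans[OF key value_match[OF at(3)]] at(4) eq True by (simp add: algebra_simps)
      then have "reaches (6 * N * length (v # vs)) (conf 4 a b c)
          (conf 6 (a + int (length (bits x))) (b + int ?n) (c + int ?n))"
        by (rule reaches_mono) (use len in simp)
      moreover have "?n < length (enc_labeling (v # vs) \<phi>)" "?n < length (enc_labeling (v # vs) \<chi>)"
        using eq True by (auto simp: enc_labeling_Cons length_enc_num)
      ultimately show ?thesis unfolding if_P[OF eq] by blast
    next
      case False
      then obtain C where "fst C = 14" "reaches (length (enc_num (\<phi> v)))
          (conf 5 (a + int (length (bits x))) (b + ?l v) (c + ?l v)) C"
        using value_mismatch[OF at(3,4)] True by blast
      moreover from reaches_trans[OF key this(2)]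
      have "reaches (6 * N * length (v # vs)) (conf 4 a b c) C"
        by (rule reaches_mono) (use len in simp)
      ultimately show ?thesis unfolding if_not_P[OF False] by blast
    qed
  next
    case False
    obtain k where k: "k \<le> length (bits x)" and
      "reaches (length (enc_num v) + 1) (conf 4 a b c) (conf 10 (a + int k) (b + ?l v) (c + ?l v))"
      using key_mismatch[OF assms(2) at(1) False] .
    note this(2)
    also have "reaches (length (enc_num (\<phi> v))) (conf 10 (a + int k) (b + ?l v) (c + ?l v))
        (conf 11 (a + int k) (b + ?l v + ?l (\<phi> v)) (c + ?l v))"
      using skip_10[of "b + ?l v" "bits (\<phi> v)"] at(3) Comma_notin_bits
      by (simp add: enc_num_def algebra_simps)
    also have "reaches (length (enc_num (\<chi> v)))
        (conf 11 (a + int k) (b + ?l v + ?l (\<phi> v)) (c + ?l v))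
        (conf 12 (a + int k) (b + ?l v + ?l (\<phi> v)) (c + ?l v + ?l (\<chi> v)))"
      using skip_11[of "c + ?l v" "bits (\<chi> v)"] at(4) Comma_notin_bits
      by (simp add: enc_num_def algebra_simps)
    also have "reaches (k + 2)
        (conf 12 (a + int k) (b + ?l v + ?l (\<phi> v)) (c + ?l v + ?l (\<chi> v)))
        (conf 4 a (b + ?l v + ?l (\<phi> v)) (c + ?l v + ?l (\<chi> v)))"
    proof -
      have "barrier {Hash, Semicolon} (a - 1) (a - 1 + (int k + 1))"
        \<comment> \<open>Head A is at \<open>a + int k\<close>, which is \<open>k + 1\<close> cells
          to the right of the separator at \<open>a - 1\<close>; the rewind ends on
          \<open>a\<close>.\<close>
        using assms(2,3) k Hash_notin_enc_num[of x] Semicolon_notin_enc_num[of x]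
        by (intro barrier_word_at[where s = "enc_num x"]) (auto simp: length_enc_num)
      from rewind_12[OF this] show ?thesis by (simp add: nat_add_distrib algebra_simps)
    qed
    \<comment> \<open>The key and the value in the first table take at most \<open>N + 1\<close>
      steps, the value in the second at most \<open>N\<close>, the rewind at most
      \<open>N + 1\<close>; as \<open>1 \<le> N\<close>, the sum is below
      \<open>6 * N\<close>.\<close>
    finally have next_entry: "reaches (6 * N) (conf 4 a b c)
        (conf 4 a (b + ?l v + ?l (\<phi> v)) (c + ?l v + ?l (\<chi> v)))"
      by (rule reaches_mono) (use len k assms(6) N in \<open>simp add: length_enc_num\<close>)
    have T: "6 * N * length (v # vs) = 6 * N + 6 * N * length vs" by simp
    have vs: "x \<in> set vs" "length (enc_labeling vs \<phi>) \<le> N" "length (enc_labeling vs \<chi>) \<le> N"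
      using Cons.prems(1) False len by auto
    note IH = Cons.IH[OF vs(1) at(5,6) vs(2,3)]
    show ?thesis
    proof (cases "\<phi> x = \<chi> x")
      case True
      with IH obtain i j where ij: "i < length (enc_labeling vs \<phi>)" "j < length (enc_labeling vs \<chi>)"
        and r: "reaches (6 * N * length vs) (conf 4 a (b + ?l v + ?l (\<phi> v)) (c + ?l v + ?l (\<chi> v)))
          (conf 6 (a + int (length (bits x))) (b + ?l v + ?l (\<phi> v) + int i) (c + ?l v + ?l (\<chi> v) + int j))"
        by auto
      let ?i = "length (enc_num v) + length (enc_num (\<phi> v)) + i"
      let ?j = "length (enc_num v) + length (enc_num (\<chi> v)) + j"
      have "reaches (6 * N * length (v # vs)) (conf 4 a b c)
          (conf 6 (a + int (length (bits x))) (b + int ?i) (c + int ?j))"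
        using reaches_trans[OF next_entry r] unfolding T by (simp add: algebra_simps)
      moreover have "?i < length (enc_labeling (v # vs) \<phi>)" "?j < length (enc_labeling (v # vs) \<chi>)"
        using ij by (auto simp: enc_labeling_Cons)
      ultimately show ?thesis unfolding if_P[OF True] by (intro exI[of _ ?i] exI[of _ ?j] conjI)
    next
      case neq: False
      with IH obtain C where C: "fst C = 14" and
        r: "reaches (6 * N * length vs) (conf 4 a (b + ?l v + ?l (\<phi> v)) (c + ?l v + ?l (\<chi> v))) C"
        by auto
      have "reaches (6 * N * length (v # vs)) (conf 4 a b c) C"
        using reaches_trans[OF next_entry r] unfolding T .
      then show ?thesis unfolding if_not_P[OF neq] using C by (intro exI[of _ C] conjI)
    qed
  qed
qed

text \<open>Induction on the edge list: after a successful edge, heads B and C are back at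
  \<open>b\<close> and \<open>c\<close> and head A is on the next edge. The cell before an edge
  holds \<open>Hash\<close> for the first edge and \<open>Semicolon\<close> for later ones; the
  closing \<open>Hash\<close> leads to acceptance.\<close>

lemma check_edges:
  assumes "\<forall>e\<in>set es. fst e \<in> set vs"
    and "word_at f a (enc_edges ps es @ [Hash])" "f (a - 1) \<in> {sym_code Hash, sym_code Semicolon}"
    and "f (b - 1) = sym_code Hash" "word_at f b (enc_labeling vs \<phi>)"
    and "f (c - 1) = sym_code Hash" "word_at f c (enc_labeling vs \<chi>)"
    and "length (enc_edges ps es) \<le> N"
    and "length (enc_labeling vs \<phi>) \<le> N" "length (enc_labeling vs \<chi>) \<le> N"
  shows "\<exists>C. fst C = (if \<forall>e\<in>set es. \<phi> (fst e) = \<chi> (fst e) then 13 else 14) \<and>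
    reaches ((6 * N * length vs + 3 * N + 4) * length es + 1) (conf 4 a b c) C"
  using assms(1,2,3,8)
proof (induction es arbitrary: a)
  case Nil
  have "reaches 1 (conf 4 a b c) (conf 13 a b c)"
    using conf_step[of 4 a b c 13 Stay Stay Stay] Nil by (simp add: enc_edges_Nil program_def)
  then show ?case by (intro exI[of _ "conf 13 a b c"]) simp
next
  case (Cons e es)
  obtain x y where e: "e = (x, y)" by (cases e)
  define r where "r = enc_num y @ enc_pairs (ps e)"
  define a' where "a' = a + int (length (enc_num x)) + int (length r) + 1"
  have enc: "enc_edges ps (e # es) = enc_num x @ r @ [Semicolon] @ enc_edges ps es"
    by (simp add: r_def e enc_edges_Cons)
  have at: "word_at f a (enc_num x)" "word_at f (a + int (length (enc_num x))) (r @ [Semicolon])"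
    "word_at f a' (enc_edges ps es @ [Hash])" "f (a' - 1) = sym_code Semicolon"
    using Cons.prems(2) unfolding enc a'_def by (simp_all add: word_at_append algebra_simps)
  have len: "length (enc_num x) + length r + 1 + length (enc_edges ps es) \<le> N"
    using Cons.prems(4) unfolding enc by simp
  have x: "x \<in> set vs" using Cons.prems(1) e by simp
  have N: "length (enc_num x) \<le> N" using len by simp
  note find = lookup[OF x at(1) Cons.prems(3) assms(5,7) N assms(9,10)]
  let ?T = "6 * N * length vs + 3 * N + 4"
  show ?case
  proof (cases "\<phi> x = \<chi> x")
    case True
    let ?a = "a + int (length (bits x))"
    from find True obtain i j where
      i: "i < length (enc_labeling vs \<phi>)" and j: "j < length (enc_labeling vs \<chi>)" and
      "reaches (6 * N * length vs) (conf 4 a b c) (conf 6 ?a (b + int i) (c + int j))"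
      by auto
    note this(3)
    also have "reaches (i + 2) (conf 6 ?a (b + int i) (c + int j)) (conf 7 ?a b (c + int j))"
    proof -
      have "barrier {Hash} (b - 1) (b - 1 + (int i + 1))"
        using assms(4,5) i Hash_notin_enc_labeling
        by (intro barrier_word_at[where s = "enc_labeling vs \<phi>"]) auto
      from rewind_6[OF this] show ?thesis by (simp add: nat_add_distrib algebra_simps)
    qed
    also have "reaches (j + 2) (conf 7 ?a b (c + int j)) (conf 8 ?a b c)"
    proof -
      have "barrier {Hash} (c - 1) (c - 1 + (int j + 1))"
        using assms(6,7) j Hash_notin_enc_labeling
        by (intro barrier_word_at[where s = "enc_labeling vs \<chi>"]) auto
      from rewind_7[OF this] show ?thesis by (simp add: nat_add_distrib algebra_simps)
    qed
    also have "reaches (length r + 2) (conf 8 ?a b c) (conf 4 a' b c)"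
    proof -
      \<comment> \<open>Head A still stands on the comma after \<open>x\<close>, so the skip starts
        there. Neither \<open>y\<close> nor the admissible pairs contain a semicolon, so it ends
        with the edge.\<close>
      have "word_at f ?a ((Comma # r) @ [Semicolon])"
        using at(1,2) by (simp add: enc_num_def word_at_append algebra_simps)
      moreover have "Semicolon \<notin> set (Comma # r)"
        using Semicolon_notin_enc_num Semicolon_notin_enc_pairs by (simp add: r_def)
      ultimately show ?thesis
        using skip_8[of ?a "Comma # r" b c] by (simp add: a'_def length_enc_num algebra_simps)
    qed
    \<comment> \<open>Two rewinds and the skip take \<open>i + j + length r + 6\<close> steps. As
      \<open>i\<close>, \<open>j\<close> and \<open>length r\<close> are below \<open>N\<close>,
      this fits into \<open>3 * N + 4\<close>.\<close>
    finally have next_edge: "reaches ?T (conf 4 a b c) (conf 4 a' b c)"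
      by (rule reaches_mono) (use i j len assms(9,10) in \<open>simp add: length_enc_num\<close>)
    obtain C where C: "fst C = (if \<forall>e\<in>set es. \<phi> (fst e) = \<chi> (fst e) then 13 else 14)"
      "reaches (?T * length es + 1) (conf 4 a' b c) C"
      using Cons.IH[of a'] Cons.prems(1) at(3,4) len by auto
    have "?T * length (e # es) + 1 = ?T + (?T * length es + 1)" by simp
    then have "reaches (?T * length (e # es) + 1) (conf 4 a b c) C"
      using reaches_trans[OF next_edge C(2)] by metis
    then show ?thesis using C(1) True e by (intro exI[of _ C]) simp
  next
    case False
    with find obtain C where C: "fst C = 14" "reaches (6 * N * length vs) (conf 4 a b c) C" by auto
    from this(2) have "reaches (?T * length (e # es) + 1) (conf 4 a b c) C"
      by (rule reaches_mono) simp
    then show ?thesis using C(1) False e by (intro exI[of _ C]) simp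
  qed
qed

section \<open>Preparation of the tapes and heads\<close>

text \<open>Starting at the right end, the three scans find the last three separators, since the
  fields \<open>v1\<close>, \<open>v2\<close>, \<open>v3\<close> contain none; the prefix
  \<open>u\<close> need not be parsed and may itself contain \<open>Hash\<close>. Each scan leaves
  one head at the start of its field.\<close>

lemma place_heads:
  assumes w: "word_at f 0 (u @ [Hash] @ v1 @ [Hash] @ v2 @ [Hash] @ v3)"
    and H: "Hash \<notin> set v1" "Hash \<notin> set v2" "Hash \<notin> set v3"
    and a: "a = int (length u) + 1" and b: "b = a + int (length v1) + 1"
    and c: "c = b + int (length v2) + 1" and r: "r = c + int (length v3) - 1"
  shows "reaches (length v1 + length v2 + length v3 + 3) (conf 1 r r r) (conf 4 a b c)"
proof -
  have at: "f (a - 1) = sym_code Hash" "word_at f a v1" "f (b - 1) = sym_code Hash" "word_at f b v2"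
    "f (c - 1) = sym_code Hash" "word_at f c v3"
    using w unfolding a b c by (simp_all add: word_at_append algebra_simps)
  have "barrier {Hash} (c - 1) (c - 1 + int (length v3))"
    using at H by (intro barrier_word_at[where s = v3]) auto
  from place_1[OF this]
  have "reaches (length v3 + 1) (conf 1 r r r) (conf 2 (c - 2) (c - 2) c)"
    by (simp add: r algebra_simps)
  also have "barrier {Hash} (b - 1) (b - 1 + int (length v2))"
    using at H by (intro barrier_word_at[where s = v2]) auto
  from place_2[OF this, of c]
  have "reaches (length v2 + 1) (conf 2 (c - 2) (c - 2) c) (conf 3 (b - 2) b c)"
    by (simp add: c algebra_simps)
  also have "barrier {Hash} (a - 1) (a - 1 + int (length v1))"
    using at H by (intro barrier_word_at[where s = v1]) auto
  from place_3[OF this, of b c]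
  have "reaches (length v1 + 1) (conf 3 (b - 2) b c) (conf 4 a b c)"
    by (simp add: b algebra_simps)
  finally show ?thesis by (rule reaches_mono) simp
qed

end

text \<open>No input symbol has code 0, so the first blank marks the end of the input; the extra
  step turns the heads back to its last cell.\<close>

lemma copy_input:
  fixes w :: "sym list"
  defines "f \<equiv> fst (input_tape w)" and "r \<equiv> int (length w) - 1"
  shows "reaches (length w + 1) (init_config machine w) (conf f 1 r r r)"
proof -
  \<comment> \<open>Contents of the second and third tape after \<open>t\<close> steps: the first
    \<open>t\<close> symbols of the input, blank elsewhere.\<close>
  define g where "g t = (\<lambda>i. if i < int t then f i else 0)" for t
  have f: "f i = (if 0 \<le> i \<and> i < int (length w) then sym_code (w ! nat i) else 0)" for i
    by (simp add: f_def input_tape_def)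
  have run: "(step machine ^^ t) (init_config machine w) = (0, [(f, int t), (g t, int t), (g t, int t)])"
    if "t \<le> length w" for t
    using that
  proof (induction t)
    case 0
    have "g 0 = (\<lambda>_. 0)" by (auto simp: g_def f)
    then show ?case
      by (simp add: init_config_def empty_tape_def f_def input_tape_def numeral_2_eq_2)
  next
    case (Suc t)
    have "(g t)(int t := f (int t)) = g (Suc t)" by (auto simp: g_def)
    moreover have "f (int t) \<noteq> 0" using Suc.prems by (simp add: f)
    then have "program 0 (f (int t)) b c = (0, Move_Right, Move_Right, Move_Right)" for b c
      by (simp add: program_def)
    ultimately show ?case using Suc
      by (simp add: step_def halted_def read_tape_def act_tape_def machine_def add.commute)
  qed
  have "g (length w) = f" by (auto simp: g_def f)
  moreover have "f (int (length w)) = 0" by (simp add: f)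
  then have "program 0 (f (int (length w))) b c = (1, Move_Left, Move_Left, Move_Left)" for b c
    by (simp add: program_def)
  ultimately have "(step machine ^^ (length w + 1)) (init_config machine w) = conf f 1 r r r"
    using run[OF order_refl] \<open>f (int (length w)) = 0\<close>
    by (simp add: step_def halted_def read_tape_def act_tape_def machine_def conf_def r_def fun_upd_idem)
  then show ?thesis unfolding reaches_def by blast
qed

text \<open>Chains copying, placement of the heads and the edge loop, with the input length as the
  bound \<open>N\<close>.\<close>

lemma machine_correct:
  assumes w: "w = u @ [Hash] @ enc_edges ps es @ [Hash] @ enc_labeling vs \<phi> @ [Hash] @ enc_labeling vs \<chi>"
    and es: "\<forall>e\<in>set es. fst e \<in> set vs"
  shows "answers_within machine w (poly [:10, 8, 3, 6:] (length w))
    (\<forall>e\<in>set es. \<phi> (fst e) = \<chi> (fst e))"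
proof -
  define f where "f = fst (input_tape w)"
  define n where "n = length w"
  define r a b c where "r = int n - 1" and a: "a = int (length u) + 1"
    and b: "b = a + int (length (enc_edges ps es)) + 1"
    and c: "c = b + int (length (enc_labeling vs \<phi>)) + 1"
  have r: "r = c + int (length (enc_labeling vs \<chi>)) - 1"
    unfolding r_def n_def a b c by (simp add: w)
  have n: "length (enc_edges ps es) + length (enc_labeling vs \<phi>) + length (enc_labeling vs \<chi>) \<le> n"
    by (simp add: n_def w)
  have f: "word_at f 0 (u @ [Hash] @ enc_edges ps es @ [Hash] @ enc_labeling vs \<phi> @ [Hash] @ enc_labeling vs \<chi>)"
    unfolding w[symmetric] f_def by (rule word_at_input_tape)
  have at: "f (a - 1) = sym_code Hash" "word_at f a (enc_edges ps es @ [Hash])"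
    "f (b - 1) = sym_code Hash" "word_at f b (enc_labeling vs \<phi>)"
    "f (c - 1) = sym_code Hash" "word_at f c (enc_labeling vs \<chi>)"
    using f unfolding a b c by (simp_all add: word_at_append algebra_simps)
  let ?e = "(6 * n * length vs + 3 * n + 4) * length es + 1"
  obtain C where C: "fst C = (if \<forall>e\<in>set es. \<phi> (fst e) = \<chi> (fst e) then 13 else 14)"
    "reaches ?e (conf f 4 a b c) C"
    using check_edges[OF es, of f a ps b \<phi> c \<chi> n] at n by auto
  have "reaches (n + 1) (init_config machine w) (conf f 1 r r r)"
    using copy_input[of w] by (simp add: f_def n_def r_def)
  also have "reaches (length (enc_edges ps es) + length (enc_labeling vs \<phi>) +
      length (enc_labeling vs \<chi>) + 3) (conf f 1 r r r) (conf f 4 a b c)"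
    using Hash_notin_enc_edges Hash_notin_enc_labeling f
    by (intro place_heads[where u = u]) (use a b c r in auto)
  also note C(2)
  finally have "reaches (poly [:10, 8, 3, 6:] n) (init_config machine w) C"
  proof (rule reaches_mono)
    \<comment> \<open>With at most \<open>n\<close> table entries and \<open>n\<close> edges the
      loop takes at most \<open>6*n^3 + 3*n^2 + 4*n + 1\<close> steps. Copying and placement add at
      most \<open>2*n + 4\<close>, so the polynomial leaves some slack.\<close>
    have "length vs \<le> n" "length es \<le> n"
      using length_vs_le_enc_labeling[of vs \<phi>] length_es_le_enc_edges[of es ps] n by linarith+
    then have "?e \<le> (6 * n * n + 3 * n + 4) * n + 1"
      by (intro add_mono mult_mono) auto
    also have "\<dots> = n * (n * (n * 6 + 3)) + 4 * n + 1" by (simp add: algebra_simps)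
    finally show "n + 1 + (length (enc_edges ps es) + length (enc_labeling vs \<phi>) +
        length (enc_labeling vs \<chi>) + 3) + ?e \<le> poly [:10, 8, 3, 6:] n"
      using n by (simp add: algebra_simps)
  qed
  moreover have "halted machine C" using C(1) by (simp add: halted_def)
  ultimately show ?thesis
    using reaches_halted C(1) by (simp add: answers_within_def run_def n_def)
qed

theorem theorem5:
  shows "\<exists>(M :: tm) (p :: nat poly).
    turing_machine M \<and>
    (\<forall>(G :: (nat, nat) game) (\<psi>s :: nat \<Rightarrow> nat) (\<psi>t :: nat \<Rightarrow> nat) (w :: sym list).
       projection_game G \<and> satisfiable G \<and> satisfying G \<psi>s \<and> satisfying G \<psi>t \<and>
       encodes w G \<psi>s \<psi>t \<longrightarrow>
       answers_within M w (poly p (length w)) (reconfigurable G \<psi>s \<psi>t))"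
proof (intro exI conjI allI impI)
  show "turing_machine machine" by (rule turing_machine_machine)
  fix G :: "(nat, nat) game" and \<psi>s \<psi>t :: "nat \<Rightarrow> nat" and w :: "sym list"
  assume asm: "projection_game G \<and> satisfiable G \<and> satisfying G \<psi>s \<and> satisfying G \<psi>t \<and>
       encodes w G \<psi>s \<psi>t"
  then obtain xs ys as es ps where
    sets: "set xs = left_part G" "set es = edge_set G" and
    w: "w = (enc_nums xs @ [Hash] @ enc_nums ys @ [Hash] @ enc_nums as) @ [Hash] @
      enc_edges ps es @ [Hash] @ enc_labeling (xs @ ys) \<psi>s @ [Hash] @ enc_labeling (xs @ ys) \<psi>t"
    unfolding encodes_def by force
  \<comment> \<open>Left endpoints of edges are vertices, so every search in the tables
    succeeds.\<close>
  have "\<forall>e\<in>set es. fst e \<in> set (xs @ ys)"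
    using asm sets by (force simp: projection_game_def is_game_def)
  from machine_correct[OF w this]
  show "answers_within machine w (poly [:10, 8, 3, 6:] (length w)) (reconfigurable G \<psi>s \<psi>t)"
    using asm sets by (simp add: reconfigurable_iff_agree case_prod_beta)
qed

end
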